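(* Consider the mesh patterns $$m_1=(12,\{(0,0),(0,1),(1,1),(1,2),(2,0),(2,1)\}),$$ $$m_2=(21,\{(0,0),(0,1),(1,1),(1,2),(2,0),(2,1)\}),$$ $$m_3=(21,\{(0,1),(0,2),(1,0),(1,1),(1,2),(2,1)\}),$$ $$m_4=(21,\{(0,1),(0,2),(1,0),(1,1),(1,2),(2,0)\}).$$ These four patterns are Wilf-equivalent under $231$: for all $n\ge0$ the numbers $|\mathrm{Av}_n(\{231,m_i\})|$, $i=1,2,3,4$, are equal. Moreover their common generating function $P(x)=\sum_{n\ge0}|\mathrm{Av}_n(\{231,m_i\})|x^n$ satisfies $$P(x)=1+xP(x)M(x),\qquad M(x)=1+xC(x)(C(x)-1),$$ where $C(x)$ is the Catalan generating function, i.e. the power series satisfying $C(x)=1+xC(x)^2$.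
   Context: Write $[n]=\{1,\dots,n\}$. A permutation of length $n$ is a bijection of $[n]$, written in one-line notation; $G(\pi)=\{(i,\pi(i)) : i\in[n]\}$ is its plot. A mesh pattern of length $k$ is a pair $p=(\tau,R)$ with $\tau$ a permutation of length $k$ and $R\subseteq\{0,\dots,k\}^2$. An occurrence of $p$ in a permutation $\pi$ of length $n$ is a subset $\omega\subseteq G(\pi)$ for which there are order-preserving injections $\alpha,\beta:[k]\to[n]$ such that (i) $\omega=\{(\alpha(i),\beta(j)):(i,j)\in G(\tau)\}$, and (ii) with $\alpha(0)=\beta(0)=0$, $\alpha(k+1)=\beta(k+1)=n+1$ and $R_{ij}=[\alpha(i)+1,\alpha(i+1)-1]\times[\beta(j)+1,\beta(j+1)-1]$, one has $R_{ij}\cap G(\pi)=\emptyset$ for every $(i,j)\in R$. A permutation avoids $p$ if it has no occurrence of $p$. A classical pattern $\pi$ is identified with the mesh pattern $(\pi,\emptyset)$. $\mathrm{Av}_n(S)$ is the set of all permutations of length $n$ (including the empty permutation for $n=0$) avoiding every pattern in $S$. *)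

theory Defs
  imports
    "HOL-Combinatorics.Multiset_Permutations"
    "HOL-Computational_Algebra.Formal_Power_Series"
begin

text \<open>A permutation of length \<open>n\<close> is represented by its one-line notation, i.e. by an
  element of \<^term>\<open>permutations_of_set {1..n}\<close>.  Positions and values are counted from 1
  whereas list indices start at 0, so \<open>\<pi>(i)\<close> is \<^term>\<open>\<pi> ! (i - 1)\<close>.\<close>

type_synonym perm = "nat list"

definition plot :: "perm \<Rightarrow> (nat \<times> nat) set" where
  "plot \<pi> = {(i, \<pi> ! (i - 1)) | i. i \<in> {1..length \<pi>}}"

type_synonym mesh_pattern = "perm \<times> (nat \<times> nat) set"

definition is_mesh_pattern :: "mesh_pattern \<Rightarrow> bool" where
  "is_mesh_pattern p \<longleftrightarrow> (case p of (\<tau>, R) \<Rightarrow>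
     \<tau> \<in> permutations_of_set {1..length \<tau>} \<and> R \<subseteq> {0..length \<tau>} \<times> {0..length \<tau>})"

definition classical :: "perm \<Rightarrow> mesh_pattern" where
  "classical \<tau> = (\<tau>, {})"

text \<open>An order-preserving injection \<open>[k] \<rightarrow> [n]\<close>, extended to \<open>0\<close> and \<open>k + 1\<close> by the
  boundary values \<open>0\<close> and \<open>n + 1\<close>.  Its values beyond \<open>k + 1\<close> are irrelevant.\<close>

definition embedding :: "nat \<Rightarrow> nat \<Rightarrow> (nat \<Rightarrow> nat) \<Rightarrow> bool" where
  "embedding k n \<alpha> \<longleftrightarrow>
     \<alpha> ` {1..k} \<subseteq> {1..n} \<and> strict_mono_on {1..k} \<alpha> \<and> \<alpha> 0 = 0 \<and> \<alpha> (k + 1) = n + 1"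

text \<open>The truncated subtractions below are harmless: an embedding is positive at \<open>i + 1\<close>
  for every \<open>i \<le> k\<close>.\<close>

definition region :: "(nat \<Rightarrow> nat) \<Rightarrow> (nat \<Rightarrow> nat) \<Rightarrow> nat \<Rightarrow> nat \<Rightarrow> (nat \<times> nat) set" where
  "region \<alpha> \<beta> i j = {\<alpha> i + 1..\<alpha> (i + 1) - 1} \<times> {\<beta> j + 1..\<beta> (j + 1) - 1}"

definition occurrence :: "mesh_pattern \<Rightarrow> perm \<Rightarrow> (nat \<times> nat) set \<Rightarrow> bool" where
  "occurrence p \<pi> \<omega> \<longleftrightarrow> (case p of (\<tau>, R) \<Rightarrow>
     \<omega> \<subseteq> plot \<pi> \<and>
     (\<exists>\<alpha> \<beta>. embedding (length \<tau>) (length \<pi>) \<alpha> \<and> embedding (length \<tau>) (length \<pi>) \<beta> \<and>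
        \<omega> = {(\<alpha> i, \<beta> j) | i j. (i, j) \<in> plot \<tau>} \<and>
        (\<forall>(i, j) \<in> R. region \<alpha> \<beta> i j \<inter> plot \<pi> = {})))"

definition avoids :: "perm \<Rightarrow> mesh_pattern \<Rightarrow> bool" where
  "avoids \<pi> p \<longleftrightarrow> \<not> (\<exists>\<omega>. occurrence p \<pi> \<omega>)"

definition Av :: "nat \<Rightarrow> mesh_pattern set \<Rightarrow> perm set" where
  "Av n S = {\<pi> \<in> permutations_of_set {1..n}. \<forall>p\<in>S. avoids \<pi> p}"

definition Av_gf :: "mesh_pattern set \<Rightarrow> int fps" where
  "Av_gf S = Abs_fps (\<lambda>n. int (card (Av n S)))"

definition m1 :: mesh_pattern where
  "m1 = ([1, 2], {(0,0), (0,1), (1,1), (1,2), (2,0), (2,1)})"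

definition m2 :: mesh_pattern where
  "m2 = ([2, 1], {(0,0), (0,1), (1,1), (1,2), (2,0), (2,1)})"

definition m3 :: mesh_pattern where
  "m3 = ([2, 1], {(0,1), (0,2), (1,0), (1,1), (1,2), (2,1)})"

definition m4 :: mesh_pattern where
  "m4 = ([2, 1], {(0,1), (0,2), (1,0), (1,1), (1,2), (2,0)})"

lemma is_mesh_pattern_231: "is_mesh_pattern (classical [2, 3, 1])"
  by (auto simp: is_mesh_pattern_def classical_def permutations_of_set_def)

lemma is_mesh_pattern_m: "\<forall>m \<in> {m1, m2, m3, m4}. is_mesh_pattern m"
  by (auto simp: is_mesh_pattern_def m1_def m2_def m3_def m4_def permutations_of_set_def)

definition catalan_gf :: "int fps" where
  "catalan_gf = (THE C. C = 1 + fps_X * C ^ 2)"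

fun catalan_number :: "nat \<Rightarrow> int" where
  "catalan_number 0 = 1"
| "catalan_number (Suc n) = (\<Sum>i\<le>n. catalan_number i * catalan_number (n - i))"

lemma catalan_gf_ex1: "\<exists>!C :: int fps. C = 1 + fps_X * C ^ 2"
proof (rule ex_ex1I)
  have "Abs_fps catalan_number = 1 + fps_X * Abs_fps catalan_number ^ 2"
  proof (rule fps_ext)
    fix n
    show "fps_nth (Abs_fps catalan_number) n = fps_nth (1 + fps_X * Abs_fps catalan_number ^ 2) n"
    proof (cases n)
      case (Suc k)
      have "fps_nth (fps_X * Abs_fps catalan_number ^ 2) n = fps_nth (Abs_fps catalan_number ^ 2) k"
        by (simp add: Suc)
      then show ?thesis
        by (simp add: Suc power2_eq_square fps_mult_nth atLeast0AtMost)
    qed simp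
  qed
  then show "\<exists>C :: int fps. C = 1 + fps_X * C ^ 2" ..
next
  fix C D :: "int fps"
  assume C: "C = 1 + fps_X * C ^ 2" and D: "D = 1 + fps_X * D ^ 2"
  have "C - D = fps_X * C ^ 2 - fps_X * D ^ 2"
    by (subst C, subst D) simp
  then have "(C - D) * (1 - fps_X * (C + D)) = 0"
    by (simp add: algebra_simps power2_eq_square)
  moreover have "fps_nth (1 - fps_X * (C + D)) 0 \<noteq> 0"
    by simp
  then have "1 - fps_X * (C + D) \<noteq> 0"
    by (metis fps_zero_nth)
  ultimately show "C = D"
    by simp
qed

lemma catalan_gf_eq: "catalan_gf = 1 + fps_X * catalan_gf ^ 2"
  unfolding catalan_gf_def by (rule theI' [OF catalan_gf_ex1])

end

theory Submission
  imports Defs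
begin

text \<open>A permutation \<open>a \<pi>\<close> avoids 231 iff \<open>\<pi> = B E\<close> with \<open>B < a < E\<close> entrywise and \<open>B\<close>, \<open>E\<close> avoid 231.
  Comparing \<open>a\<close> with the first point of an occurrence shows that \<open>a B E\<close> contains
  \<^item> \<open>m1\<close> iff \<open>B\<close> contains it or \<open>E\<close> starts with its minimum,
  \<^item> \<open>m2\<close> iff \<open>B\<close> contains it or \<open>B\<close> ends with its maximum,
  \<^item> \<open>m3\<close> iff \<open>E\<close> contains it or \<open>B\<close> starts with its maximum,
  \<^item> \<open>m4\<close> iff \<open>E\<close> contains it or \<open>B\<close> starts with its minimum.

  The 231-avoiders that do not start with their minimum (or maximum) have generating function
  \<open>1 + x C (C - 1) = M\<close>, which gives \<open>P = 1 + x P M\<close> for \<open>m1\<close>, \<open>m3\<close> and \<open>m4\<close>.  For \<open>m2\<close>, appending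
  a new maximum neither creates nor destroys an occurrence, so \<open>P = 1 + x (P - x P) C\<close>, and
  \<open>C - x C = M\<close>.\<close>

section \<open>Occurrences in terms of list decompositions\<close>

text \<open>Position \<open>s\<close> is list index \<open>s - 1\<close>, so the entries strictly
  between positions \<open>\<alpha> i\<close> and \<open>\<alpha> (i + 1)\<close> begin at index
  \<open>\<alpha> i\<close>. An empty box thus becomes a condition on the values in a contiguous
  segment of \<open>\<pi>\<close>.\<close>

lemma region_empty_iff:
  assumes "\<alpha> i < \<alpha> (i + 1)" "\<alpha> (i + 1) \<le> length \<pi> + 1"
  shows "region \<alpha> \<beta> i j \<inter> plot \<pi> = {} \<longleftrightarrow>
    (\<forall>x \<in> set (take (\<alpha> (i + 1) - 1 - \<alpha> i) (drop (\<alpha> i) \<pi>)). x \<le> \<beta> j \<or> \<beta> (j + 1) \<le> x)"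
    (is "?l \<longleftrightarrow> ?r")
proof
  assume l: ?l
  show ?r
  proof
    fix x assume "x \<in> set (take (\<alpha> (i + 1) - 1 - \<alpha> i) (drop (\<alpha> i) \<pi>))"
    then obtain t where t: "t < \<alpha> (i + 1) - 1 - \<alpha> i" "x = \<pi> ! (\<alpha> i + t)"
      using assms by (auto simp: in_set_conv_nth)
    have "(\<alpha> i + t + 1, x) \<in> plot \<pi>"
      using t assms by (auto simp: plot_def)
    with l have "(\<alpha> i + t + 1, x) \<notin> region \<alpha> \<beta> i j"
      by blast
    then show "x \<le> \<beta> j \<or> \<beta> (j + 1) \<le> x"
      using t assms by (auto simp: region_def)
  qed
next
  assume r: ?r
  have False if "z \<in> region \<alpha> \<beta> i j" "z \<in> plot \<pi>" for z
  proof -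
    from that obtain s where s: "s \<in> {\<alpha> i + 1..\<alpha> (i + 1) - 1}"
      "\<pi> ! (s - 1) \<in> {\<beta> j + 1..\<beta> (j + 1) - 1}"
      by (auto simp: region_def plot_def)
    have "take (\<alpha> (i + 1) - 1 - \<alpha> i) (drop (\<alpha> i) \<pi>) ! (s - 1 - \<alpha> i) = \<pi> ! (s - 1)"
      using s assms by auto
    moreover have "s - 1 - \<alpha> i < length (take (\<alpha> (i + 1) - 1 - \<alpha> i) (drop (\<alpha> i) \<pi>))"
      using s assms by auto
    ultimately have "\<pi> ! (s - 1) \<in> set (take (\<alpha> (i + 1) - 1 - \<alpha> i) (drop (\<alpha> i) \<pi>))"
      by (metis nth_mem)
    with r s show False by fastforce
  qed
  then show ?l by blast
qed

lemma atLeastAtMost_1_2: "{1..2::nat} = {1, 2}"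
  by auto

lemma plot_length_2: "plot [u, v] = {(1, u), (2, v)}"
  by (auto simp: plot_def numeral_2_eq_2 le_Suc_eq)

lemma embedding_2_iff:
  "embedding 2 n \<alpha> \<longleftrightarrow>
    \<alpha> 0 = 0 \<and> 0 < \<alpha> 1 \<and> \<alpha> 1 < \<alpha> 2 \<and> \<alpha> 2 \<le> n \<and> \<alpha> 3 = n + 1"
  unfolding embedding_def atLeastAtMost_1_2 strict_mono_on_def by auto

lemma in_permutations_of_set_iff:
  "\<pi> \<in> permutations_of_set {1..n} \<longleftrightarrow> distinct \<pi> \<and> set \<pi> = {1..n} \<and> length \<pi> = n"
  unfolding permutations_of_set_def using distinct_card[of \<pi>] by auto

text \<open>The positions \<open>\<alpha>\<close> matter only through how they cut
  \<open>\<pi>\<close>: \<open>A\<close>, \<open>B\<close>, \<open>D\<close> are the mesh columns 0,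
  1, 2. The rows stay encoded by \<open>\<beta>\<close>, since they are compared by size rather than
  by place.\<close>

lemma occurrence_length_2_iff:
  assumes R: "R \<subseteq> {0..2} \<times> {0..2}"
  shows "(\<exists>\<omega>. occurrence ([u, v], R) \<pi> \<omega>) \<longleftrightarrow>
    (\<exists>A B D \<beta>. \<pi> = A @ \<beta> u # B @ \<beta> v # D \<and> embedding 2 (length \<pi>) \<beta> \<and>
      (\<forall>(i, j) \<in> R. \<forall>x \<in> set ([A, B, D] ! i). x \<le> \<beta> j \<or> \<beta> (j + 1) \<le> x))"
    (is "?l \<longleftrightarrow> ?r")
proof
  assume ?l
  then obtain \<alpha> \<beta> where e: "embedding 2 (length \<pi>) \<alpha>" "embedding 2 (length \<pi>) \<beta>"
    and sub: "{(\<alpha> i, \<beta> j) |i j. (i, j) \<in> plot [u, v]} \<subseteq> plot \<pi>"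
    and reg: "\<forall>(i, j) \<in> R. region \<alpha> \<beta> i j \<inter> plot \<pi> = {}"
    by (auto simp: occurrence_def numeral_2_eq_2)
  have \<alpha>: "\<alpha> 0 = 0" "0 < \<alpha> 1" "\<alpha> 1 < \<alpha> 2" "\<alpha> 2 \<le> length \<pi>" "\<alpha> 3 = length \<pi> + 1"
    using e(1) by (auto simp: embedding_2_iff)
  have "(\<alpha> 1, \<beta> u) \<in> plot \<pi>" "(\<alpha> 2, \<beta> v) \<in> plot \<pi>"
    using sub unfolding plot_length_2 by blast+
  then have p: "\<pi> ! (\<alpha> 1 - 1) = \<beta> u" "\<pi> ! (\<alpha> 2 - 1) = \<beta> v"
    by (auto simp: plot_def)
  define A B D where "A = take (\<alpha> 1 - 1) \<pi>" "B = take (\<alpha> 2 - 1 - \<alpha> 1) (drop (\<alpha> 1) \<pi>)"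
    "D = drop (\<alpha> 2) \<pi>"
  note ABD = this
  have "\<pi> = A @ \<beta> u # drop (\<alpha> 1) \<pi>"
    using id_take_nth_drop[of "\<alpha> 1 - 1" \<pi>] \<alpha> p by (auto simp: ABD)
  moreover have "drop (\<alpha> 1) \<pi> = B @ \<beta> v # D"
    using id_take_nth_drop[of "\<alpha> 2 - 1 - \<alpha> 1" "drop (\<alpha> 1) \<pi>"] \<alpha> p by (auto simp: ABD)
  ultimately have s: "\<pi> = A @ \<beta> u # B @ \<beta> v # D"
    by simp
  \<comment> \<open>One formula for all three columns, with outer cuts \<open>\<alpha> 0 = 0\<close>
    and \<open>\<alpha> 3 = length \<pi> + 1\<close>, lets \<open>region_empty_iff\<close> treat
    every box alike.\<close>
  have seg: "[A, B, D] ! i = take (\<alpha> (i + 1) - 1 - \<alpha> i) (drop (\<alpha> i) \<pi>) \<and>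
      \<alpha> i < \<alpha> (i + 1) \<and> \<alpha> (i + 1) \<le> length \<pi> + 1" if "i \<le> 2" for i
  proof -
    from that consider "i = 0" | "i = 1" | "i = 2" by linarith
    then show ?thesis
      by cases (use \<alpha> in \<open>auto simp: ABD numeral_2_eq_2 numeral_3_eq_3\<close>)
  qed
  have "\<forall>(i, j) \<in> R. \<forall>x \<in> set ([A, B, D] ! i). x \<le> \<beta> j \<or> \<beta> (j + 1) \<le> x"
  proof (intro ballI, unfold split_paired_all prod.case, intro ballI)
    fix i j x assume ij: "(i, j) \<in> R" and x: "x \<in> set ([A, B, D] ! i)"
    then have "i \<le> 2" using R by auto
    note sg = seg[OF this]
    from ij reg have "region \<alpha> \<beta> i j \<inter> plot \<pi> = {}" by auto
    then show "x \<le> \<beta> j \<or> \<beta> (j + 1) \<le> x"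
      using region_empty_iff[of \<alpha> i \<pi> \<beta> j] sg x by simp
  qed
  then show ?r
    using s e(2) by blast
next
  assume ?r
  then obtain A B D \<beta> where s: "\<pi> = A @ \<beta> u # B @ \<beta> v # D"
    and e: "embedding 2 (length \<pi>) \<beta>"
    and reg: "\<forall>(i, j) \<in> R. \<forall>x \<in> set ([A, B, D] ! i). x \<le> \<beta> j \<or> \<beta> (j + 1) \<le> x"
    by blast
  \<comment> \<open>The two chosen entries sit right after \<open>A\<close> and right after
    \<open>B\<close>, counted from 1; the outer two values are the boundary ones.\<close>
  define \<alpha> where "\<alpha> = (\<lambda>i::nat. [0, length A + 1, length A + length B + 2, length \<pi> + 1] ! i)"
  have \<alpha>: "\<alpha> 0 = 0" "\<alpha> 1 = length A + 1" "\<alpha> 2 = length A + length B + 2" "\<alpha> 3 = length \<pi> + 1"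
    by (simp_all add: \<alpha>_def)
  have e\<alpha>: "embedding 2 (length \<pi>) \<alpha>"
    using \<alpha> s by (auto simp: embedding_2_iff)
  have seg: "[A, B, D] ! i = take (\<alpha> (i + 1) - 1 - \<alpha> i) (drop (\<alpha> i) \<pi>) \<and>
      \<alpha> i < \<alpha> (i + 1) \<and> \<alpha> (i + 1) \<le> length \<pi> + 1" if "i \<le> 2" for i
  proof -
    from that consider "i = 0" | "i = 1" | "i = 2" by linarith
    then show ?thesis
      by cases (simp_all add: \<alpha>_def s)
  qed
  have "region \<alpha> \<beta> i j \<inter> plot \<pi> = {}" if "(i, j) \<in> R" for i j
  proof -
    have "i \<le> 2" using that R by auto
    from seg[OF this] show ?thesis
      using region_empty_iff[of \<alpha> i \<pi> \<beta> j] reg that by fastforce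
  qed
  moreover have "{(\<alpha> i, \<beta> j) |i j. (i, j) \<in> plot [u, v]} \<subseteq> plot \<pi>"
    unfolding plot_length_2 using \<alpha> s by (auto simp: plot_def nth_append)
  ultimately have "occurrence ([u, v], R) \<pi> {(\<alpha> i, \<beta> j) |i j. (i, j) \<in> plot [u, v]}"
    unfolding occurrence_def prod.case
    by (intro conjI exI[of _ \<alpha>] exI[of _ \<beta>] refl) (use e e\<alpha> in \<open>auto simp: numeral_2_eq_2\<close>)
  then show ?l ..
qed

lemma embedding_2_values:
  assumes "p < q" "p \<in> {1..n}" "q \<in> {1..n}"
  obtains \<beta> where "embedding 2 n \<beta>" "\<beta> 1 = p" "\<beta> 2 = q"
  by (rule that[of "\<lambda>i. [0, p, q, n + 1] ! i"]) (use assms in \<open>auto simp: embedding_2_iff\<close>)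

text \<open>The value \<open>x\<close> lies in row \<open>j\<close> of the mesh cut out by the values \<open>p < q\<close>.\<close>

definition in_band :: "nat \<Rightarrow> nat \<Rightarrow> nat \<Rightarrow> nat \<Rightarrow> bool" where
  "in_band p q j x \<longleftrightarrow> (if j = 0 then x < p else if j = 1 then p < x \<and> x < q else q < x)"

text \<open>Values in \<open>{1..n}\<close> always respect the bounds 0 and \<open>n + 1\<close>, so
  the rows can be described by the two inner values alone.\<close>

lemma in_band_iff:
  assumes "embedding 2 n \<beta>" "j \<le> 2" "x \<in> {1..n}"
  shows "(x \<le> \<beta> j \<or> \<beta> (j + 1) \<le> x) \<longleftrightarrow> \<not> in_band (\<beta> 1) (\<beta> 2) j x"
proof -
  from assms(2) consider "j = 0" | "j = 1" | "j = 2" by linarith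
  then show ?thesis
    by cases (use assms(1,3) in \<open>auto simp: in_band_def embedding_2_iff simp flip: One_nat_def\<close>)
qed

text \<open>\<open>[p, q] ! (u - 1)\<close> picks the smaller or the larger value according to the
  pattern entry \<open>u\<close>, so one statement serves both 12 and 21. Any two entries
  \<open>p < q\<close> are the inner values of some embedding, which eliminates
  \<open>\<beta>\<close>.\<close>

lemma contains_length_2_iff:
  assumes "R \<subseteq> {0..2} \<times> {0..2}" and \<pi>: "\<pi> \<in> permutations_of_set {1..n}"
    and uv: "{u, v} = {1, 2::nat}"
  shows "\<not> avoids \<pi> ([u, v], R) \<longleftrightarrow>
    (\<exists>A B D p q. \<pi> = A @ [p, q] ! (u - 1) # B @ [p, q] ! (v - 1) # D \<and> p < q \<and>
      (\<forall>(i, j) \<in> R. \<forall>x \<in> set ([A, B, D] ! i). \<not> in_band p q j x))"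
    (is "_ \<longleftrightarrow> ?r")
proof -
  have uv': "u = 1 \<and> v = 2 \<or> u = 2 \<and> v = 1"
    using uv by (auto simp: doubleton_eq_iff)
  have n: "length \<pi> = n" "set \<pi> = {1..n}"
    using \<pi> unfolding in_permutations_of_set_iff by auto
  have reg: "(\<forall>(i, j) \<in> R. \<forall>x \<in> set ([A, B, D] ! i). x \<le> \<beta> j \<or> \<beta> (j + 1) \<le> x) \<longleftrightarrow>
      (\<forall>(i, j) \<in> R. \<forall>x \<in> set ([A, B, D] ! i). \<not> in_band (\<beta> 1) (\<beta> 2) j x)"
    if "embedding 2 n \<beta>" "set A \<union> set B \<union> set D \<subseteq> {1..n}" for A B D \<beta>
  proof -
    have "(x \<le> \<beta> j \<or> \<beta> (j + 1) \<le> x) \<longleftrightarrow> \<not> in_band (\<beta> 1) (\<beta> 2) j x"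
      if "(i, j) \<in> R" "x \<in> set ([A, B, D] ! i)" for i j x
    proof (rule in_band_iff)
      show "embedding 2 n \<beta>" by fact
      show "j \<le> 2" using that assms(1) by auto
      have "i \<le> 2" using that assms(1) by auto
      then consider "i = 0" | "i = 1" | "i = 2" by linarith
      then have "x \<in> set A \<union> set B \<union> set D"
        by cases (use that in auto)
      then show "x \<in> {1..n}"
        using \<open>set A \<union> set B \<union> set D \<subseteq> {1..n}\<close> by blast
    qed
    then show ?thesis by blast
  qed
  have "\<not> avoids \<pi> ([u, v], R) \<longleftrightarrow>
      (\<exists>A B D \<beta>. \<pi> = A @ \<beta> u # B @ \<beta> v # D \<and> embedding 2 n \<beta> \<and>
      (\<forall>(i, j) \<in> R. \<forall>x \<in> set ([A, B, D] ! i). x \<le> \<beta> j \<or> \<beta> (j + 1) \<le> x))"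
    unfolding avoids_def by (simp only: not_not occurrence_length_2_iff[OF assms(1)] n)
  also have "\<dots> \<longleftrightarrow> ?r"
  proof
    assume "\<exists>A B D \<beta>. \<pi> = A @ \<beta> u # B @ \<beta> v # D \<and> embedding 2 n \<beta> \<and>
      (\<forall>(i, j) \<in> R. \<forall>x \<in> set ([A, B, D] ! i). x \<le> \<beta> j \<or> \<beta> (j + 1) \<le> x)"
    then obtain A B D \<beta> where *: "\<pi> = A @ \<beta> u # B @ \<beta> v # D" "embedding 2 n \<beta>"
      "\<forall>(i, j) \<in> R. \<forall>x \<in> set ([A, B, D] ! i). x \<le> \<beta> j \<or> \<beta> (j + 1) \<le> x"
      by blast
    have "set A \<union> set B \<union> set D \<subseteq> {1..n}"
      using n(2) unfolding *(1) by auto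
    with reg[OF *(2)] *(3)
    have "\<forall>(i, j) \<in> R. \<forall>x \<in> set ([A, B, D] ! i). \<not> in_band (\<beta> 1) (\<beta> 2) j x"
      by blast
    moreover have "\<beta> u = [\<beta> 1, \<beta> 2] ! (u - 1)" "\<beta> v = [\<beta> 1, \<beta> 2] ! (v - 1)" "\<beta> 1 < \<beta> 2"
      using uv' *(2) by (auto simp: embedding_2_iff)
    ultimately show ?r
      using *(1) by (intro exI[of _ A] exI[of _ B] exI[of _ D] exI[of _ "\<beta> 1"] exI[of _ "\<beta> 2"]) simp
  next
    assume ?r
    then obtain A B D p q where *: "\<pi> = A @ [p, q] ! (u - 1) # B @ [p, q] ! (v - 1) # D" "p < q"
      "\<forall>(i, j) \<in> R. \<forall>x \<in> set ([A, B, D] ! i). \<not> in_band p q j x"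
      by blast
    have sub: "set A \<union> set B \<union> set D \<union> {p, q} \<subseteq> {1..n}"
      using n(2) uv' unfolding *(1) by auto
    then have pq: "p \<in> {1..n}" "q \<in> {1..n}" by auto
    obtain \<beta> where \<beta>: "embedding 2 n \<beta>" "\<beta> 1 = p" "\<beta> 2 = q"
      by (rule embedding_2_values[OF *(2) pq])
    have "[p, q] ! (u - 1) = \<beta> u" "[p, q] ! (v - 1) = \<beta> v"
      using uv' \<beta> by auto
    moreover have "\<forall>(i, j) \<in> R. \<forall>x \<in> set ([A, B, D] ! i). x \<le> \<beta> j \<or> \<beta> (j + 1) \<le> x"
      using reg[OF \<beta>(1)] sub *(3) \<beta> by simp
    ultimately show "\<exists>A B D \<beta>. \<pi> = A @ \<beta> u # B @ \<beta> v # D \<and> embedding 2 n \<beta> \<and>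
      (\<forall>(i, j) \<in> R. \<forall>x \<in> set ([A, B, D] ! i). x \<le> \<beta> j \<or> \<beta> (j + 1) \<le> x)"
      using *(1) \<beta>(1) by (intro exI[of _ A] exI[of _ B] exI[of _ D] exI[of _ \<beta>]) simp
  qed
  finally show ?thesis .
qed

section \<open>The four patterns as predicates on lists\<close>

text \<open>Each condition names the boxes left unshaded in a column: here the top row on both sides
  and the bottom row in between. For all four patterns \<open>p\<close> is the lower and
  \<open>q\<close> the upper point.\<close>

definition contains1 :: "nat list \<Rightarrow> bool" where
  "contains1 xs \<longleftrightarrow> (\<exists>A p B q D. xs = A @ p # B @ q # D \<and> p < q \<and>
     (\<forall>x \<in> set A. q < x) \<and> (\<forall>x \<in> set B. x < p) \<and> (\<forall>x \<in> set D. q < x))"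

definition contains2 :: "nat list \<Rightarrow> bool" where
  "contains2 xs \<longleftrightarrow> (\<exists>A p B q D. xs = A @ q # B @ p # D \<and> p < q \<and>
     (\<forall>x \<in> set A. q < x) \<and> (\<forall>x \<in> set B. x < p) \<and> (\<forall>x \<in> set D. q < x))"

text \<open>Column 1 of \<open>m3\<close> and \<open>m4\<close> is entirely shaded, so the two
  points are adjacent.\<close>

definition contains3 :: "nat list \<Rightarrow> bool" where
  "contains3 xs \<longleftrightarrow> (\<exists>A p q D. xs = A @ q # p # D \<and> p < q \<and>
     (\<forall>x \<in> set A. x < p) \<and> (\<forall>x \<in> set D. x < p \<or> q < x))"

definition contains4 :: "nat list \<Rightarrow> bool" where
  "contains4 xs \<longleftrightarrow> (\<exists>A p q D. xs = A @ q # p # D \<and> p < q \<and>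
     (\<forall>x \<in> set A. x < p) \<and> (\<forall>x \<in> set D. p < x))"

text \<open>A value other than \<open>p\<close> and \<open>q\<close> falls into exactly one of three
  bands, so forbidding some bands amounts to confinement to the others.\<close>

lemma in_band_trichotomy:
  assumes "p < q" "p \<notin> X" "q \<notin> X"
  shows "(\<forall>x \<in> X. q < x) \<longleftrightarrow> (\<forall>x \<in> X. \<not> in_band p q 0 x) \<and> (\<forall>x \<in> X. \<not> in_band p q 1 x)"
    and "(\<forall>x \<in> X. x < p) \<longleftrightarrow> (\<forall>x \<in> X. \<not> in_band p q 1 x) \<and> (\<forall>x \<in> X. \<not> in_band p q 2 x)"
    and "(\<forall>x \<in> X. p < x) \<longleftrightarrow> (\<forall>x \<in> X. \<not> in_band p q 0 x)"
    and "(\<forall>x \<in> X. x < p \<or> q < x) \<longleftrightarrow> (\<forall>x \<in> X. \<not> in_band p q 1 x)"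
    and "X = {} \<longleftrightarrow> (\<forall>x \<in> X. \<not> in_band p q 0 x) \<and> (\<forall>x \<in> X. \<not> in_band p q 1 x) \<and>
      (\<forall>x \<in> X. \<not> in_band p q 2 x)"
proof -
  have 0: "x \<noteq> p \<and> x \<noteq> q" if "x \<in> X" for x
    using that assms by auto
  show "(\<forall>x \<in> X. q < x) \<longleftrightarrow> (\<forall>x \<in> X. \<not> in_band p q 0 x) \<and> (\<forall>x \<in> X. \<not> in_band p q 1 x)"
    unfolding ball_conj_distrib[symmetric]
    by (rule ball_cong[OF refl]) (use 0 assms(1) in \<open>force simp: in_band_def\<close>)
  show "(\<forall>x \<in> X. x < p) \<longleftrightarrow> (\<forall>x \<in> X. \<not> in_band p q 1 x) \<and> (\<forall>x \<in> X. \<not> in_band p q 2 x)"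
    unfolding ball_conj_distrib[symmetric]
    by (rule ball_cong[OF refl]) (use 0 assms(1) in \<open>force simp: in_band_def\<close>)
  show "(\<forall>x \<in> X. p < x) \<longleftrightarrow> (\<forall>x \<in> X. \<not> in_band p q 0 x)"
    by (rule ball_cong[OF refl]) (use 0 assms(1) in \<open>force simp: in_band_def\<close>)
  show "(\<forall>x \<in> X. x < p \<or> q < x) \<longleftrightarrow> (\<forall>x \<in> X. \<not> in_band p q 1 x)"
    by (rule ball_cong[OF refl]) (use 0 assms(1) in \<open>force simp: in_band_def\<close>)
  have "x \<notin> X" if "\<not> in_band p q 0 x" "\<not> in_band p q 1 x" "\<not> in_band p q 2 x" for x
    using that 0[of x] by (auto simp: in_band_def)
  then show "X = {} \<longleftrightarrow> (\<forall>x \<in> X. \<not> in_band p q 0 x) \<and> (\<forall>x \<in> X. \<not> in_band p q 1 x) \<and>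
      (\<forall>x \<in> X. \<not> in_band p q 2 x)"
    by blast
qed

text \<open>Distinctness keeps \<open>p\<close> and \<open>q\<close> out of the columns, so
  \<open>in_band_trichotomy\<close> applies to each. Only the set \<open>{x, y}\<close> is fixed, so
  \<open>m1\<close> and \<open>m2\<close>, which have the same shading, share the first
  equivalence.\<close>

lemma
  fixes A B D :: "nat list"
  assumes "p < q" and d: "distinct (A @ x # B @ y # D)" "{x, y} = {p, q}"
  shows mesh12_iff: "(\<forall>(i, j) \<in> {(0,0), (0,1), (1,1), (1,2), (2,0), (2,1)}. \<forall>z \<in> set ([A, B, D] ! i).
      \<not> in_band p q j z) \<longleftrightarrow> (\<forall>z \<in> set A. q < z) \<and> (\<forall>z \<in> set B. z < p) \<and> (\<forall>z \<in> set D. q < z)" (is ?A)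
    and mesh3_iff: "(\<forall>(i, j) \<in> {(0,1), (0,2), (1,0), (1,1), (1,2), (2,1)}. \<forall>z \<in> set ([A, B, D] ! i).
      \<not> in_band p q j z) \<longleftrightarrow> B = [] \<and> (\<forall>z \<in> set A. z < p) \<and> (\<forall>z \<in> set D. z < p \<or> q < z)" (is ?B)
    and mesh4_iff: "(\<forall>(i, j) \<in> {(0,1), (0,2), (1,0), (1,1), (1,2), (2,0)}. \<forall>z \<in> set ([A, B, D] ! i).
      \<not> in_band p q j z) \<longleftrightarrow> B = [] \<and> (\<forall>z \<in> set A. z < p) \<and> (\<forall>z \<in> set D. p < z)" (is ?C)
proof -
  have "p \<notin> set A" "q \<notin> set A" "p \<notin> set B" "q \<notin> set B" "p \<notin> set D" "q \<notin> set D"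
    using d by (auto simp: doubleton_eq_iff)
  note A = in_band_trichotomy[OF \<open>p < q\<close> this(1,2)] and B = in_band_trichotomy[OF \<open>p < q\<close> this(3,4)]
    and D = in_band_trichotomy[OF \<open>p < q\<close> this(5,6)]
  have nth: "[A, B, D] ! 0 = A" "[A, B, D] ! 1 = B" "[A, B, D] ! 2 = D"
    by simp_all
  show ?A ?B ?C
    \<comment> \<open>Turning \<open>B = []\<close> into \<open>set B = {}\<close> matches the last
      trichotomy equation; the rest is propositional.\<close>
    unfolding set_empty[symmetric] A B D
    by (simp_all only: ball_simps(5,7) prod.case nth conj_assoc simp_thms) argo+
qed

lemma avoids_m1_iff:
  assumes "\<pi> \<in> permutations_of_set {1..n}"
  shows "avoids \<pi> m1 \<longleftrightarrow> \<not> contains1 \<pi>"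
proof -
  let ?R = "{(0,0), (0,1), (1,1), (1,2), (2,0), (2,1)} :: (nat \<times> nat) set"
  have "\<not> avoids \<pi> m1 \<longleftrightarrow> (\<exists>A B D p q. \<pi> = A @ p # B @ q # D \<and> p < q \<and>
      (\<forall>(i, j) \<in> ?R. \<forall>z \<in> set ([A, B, D] ! i). \<not> in_band p q j z))"
    unfolding m1_def using contains_length_2_iff[OF _ assms, of ?R 1 2]
    by (simp add: insert_commute)
  also have "\<dots> \<longleftrightarrow> (\<exists>A B D p q. \<pi> = A @ p # B @ q # D \<and> p < q \<and>
      (\<forall>z \<in> set A. q < z) \<and> (\<forall>z \<in> set B. z < p) \<and> (\<forall>z \<in> set D. q < z))"
    by (intro ex_cong1 conj_cong refl mesh12_iff) (use assms in \<open>auto simp: permutations_of_set_def\<close>)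
  also have "\<dots> \<longleftrightarrow> contains1 \<pi>"
    unfolding contains1_def by blast
  finally show ?thesis by blast
qed

lemma avoids_m2_iff:
  assumes "\<pi> \<in> permutations_of_set {1..n}"
  shows "avoids \<pi> m2 \<longleftrightarrow> \<not> contains2 \<pi>"
proof -
  let ?R = "{(0,0), (0,1), (1,1), (1,2), (2,0), (2,1)} :: (nat \<times> nat) set"
  have "\<not> avoids \<pi> m2 \<longleftrightarrow> (\<exists>A B D p q. \<pi> = A @ q # B @ p # D \<and> p < q \<and>
      (\<forall>(i, j) \<in> ?R. \<forall>z \<in> set ([A, B, D] ! i). \<not> in_band p q j z))"
    unfolding m2_def using contains_length_2_iff[OF _ assms, of ?R 2 1]
    by (simp add: insert_commute)
  also have "\<dots> \<longleftrightarrow> (\<exists>A B D p q. \<pi> = A @ q # B @ p # D \<and> p < q \<and>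
      (\<forall>z \<in> set A. q < z) \<and> (\<forall>z \<in> set B. z < p) \<and> (\<forall>z \<in> set D. q < z))"
    by (intro ex_cong1 conj_cong refl mesh12_iff) (use assms in \<open>auto simp: permutations_of_set_def\<close>)
  also have "\<dots> \<longleftrightarrow> contains2 \<pi>"
    unfolding contains2_def by blast
  finally show ?thesis by blast
qed

lemma avoids_m3_iff:
  assumes "\<pi> \<in> permutations_of_set {1..n}"
  shows "avoids \<pi> m3 \<longleftrightarrow> \<not> contains3 \<pi>"
proof -
  let ?R = "{(0,1), (0,2), (1,0), (1,1), (1,2), (2,1)} :: (nat \<times> nat) set"
  have "\<not> avoids \<pi> m3 \<longleftrightarrow> (\<exists>A B D p q. \<pi> = A @ q # B @ p # D \<and> p < q \<and>
      (\<forall>(i, j) \<in> ?R. \<forall>z \<in> set ([A, B, D] ! i). \<not> in_band p q j z))"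
    unfolding m3_def using contains_length_2_iff[OF _ assms, of ?R 2 1]
    by (simp add: insert_commute)
  also have "\<dots> \<longleftrightarrow> (\<exists>A B D p q. \<pi> = A @ q # B @ p # D \<and> p < q \<and>
      B = [] \<and> (\<forall>z \<in> set A. z < p) \<and> (\<forall>z \<in> set D. z < p \<or> q < z))"
    by (intro ex_cong1 conj_cong refl mesh3_iff) (use assms in \<open>auto simp: permutations_of_set_def\<close>)
  also have "\<dots> \<longleftrightarrow> contains3 \<pi>"
    unfolding contains3_def by auto
  finally show ?thesis by blast
qed

lemma avoids_m4_iff:
  assumes "\<pi> \<in> permutations_of_set {1..n}"
  shows "avoids \<pi> m4 \<longleftrightarrow> \<not> contains4 \<pi>"
proof -
  let ?R = "{(0,1), (0,2), (1,0), (1,1), (1,2), (2,0)} :: (nat \<times> nat) set"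
  have "\<not> avoids \<pi> m4 \<longleftrightarrow> (\<exists>A B D p q. \<pi> = A @ q # B @ p # D \<and> p < q \<and>
      (\<forall>(i, j) \<in> ?R. \<forall>z \<in> set ([A, B, D] ! i). \<not> in_band p q j z))"
    unfolding m4_def using contains_length_2_iff[OF _ assms, of ?R 2 1]
    by (simp add: insert_commute)
  also have "\<dots> \<longleftrightarrow> (\<exists>A B D p q. \<pi> = A @ q # B @ p # D \<and> p < q \<and>
      B = [] \<and> (\<forall>z \<in> set A. z < p) \<and> (\<forall>z \<in> set D. p < z))"
    by (intro ex_cong1 conj_cong refl mesh4_iff) (use assms in \<open>auto simp: permutations_of_set_def\<close>)
  also have "\<dots> \<longleftrightarrow> contains4 \<pi>"
    unfolding contains4_def by auto
  finally show ?thesis by blast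
qed

section \<open>The class of 231-avoiding permutations\<close>

text \<open>\<open>sorted_wrt\<close> ranges over all pairs in list order, so the head condition
  says that \<open>a\<close> is not the 2 of a 231. Recursion on the first entry suits the later
  splitting there.\<close>

fun av231 :: "nat list \<Rightarrow> bool" where
  "av231 [] \<longleftrightarrow> True"
| "av231 (a # xs) \<longleftrightarrow> av231 xs \<and> sorted_wrt (\<lambda>x y. \<not> (y < a \<and> a < x)) xs"

text \<open>The indices \<open>i\<close>, \<open>j\<close>, \<open>k\<close> carry the 2, 3 and 1.
  Triples with \<open>i = 0\<close> give the head condition, all others shift into the tail. This
  form is the bridge to embeddings.\<close>

lemma av231_iff_nth:
  "av231 xs \<longleftrightarrow>
    (\<forall>i j k. i < j \<longrightarrow> j < k \<longrightarrow> k < length xs \<longrightarrow> \<not> (xs ! k < xs ! i \<and> xs ! i < xs ! j))"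
proof (induction xs)
  case (Cons a xs)
  show ?case (is "_ \<longleftrightarrow> ?r")
  proof
    assume l: "av231 (a # xs)"
    show ?r
    proof (intro allI impI)
      fix i j k assume ijk: "i < j" "j < k" "k < length (a # xs)"
      then obtain j' k' where jk: "j = Suc j'" "k = Suc k'"
        by (metis less_nat_zero_code not0_implies_Suc)
      show "\<not> ((a # xs) ! k < (a # xs) ! i \<and> (a # xs) ! i < (a # xs) ! j)"
        using l Cons.IH ijk by (cases i) (auto simp: jk sorted_wrt_iff_nth_less)
    qed
  next
    assume r: ?r
    have "av231 xs"
      unfolding Cons.IH
    proof (intro allI impI)
      fix i j k assume "i < j" "j < k" "k < length xs"
      then show "\<not> (xs ! k < xs ! i \<and> xs ! i < xs ! j)"
        using r[rule_format, of "Suc i" "Suc j" "Suc k"] by simp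
    qed
    moreover have "sorted_wrt (\<lambda>x y. \<not> (y < a \<and> a < x)) xs"
      unfolding sorted_wrt_iff_nth_less
    proof (intro allI impI)
      fix j k assume "j < k" "k < length xs"
      then show "\<not> (xs ! k < a \<and> a < xs ! j)"
        using r[rule_format, of 0 "Suc j" "Suc k"] by simp
    qed
    ultimately show "av231 (a # xs)"
      by simp
  qed
qed simp

lemma atLeastAtMost_1_3: "{1..3::nat} = {1, 2, 3}"
  by auto

lemma embedding_3_iff:
  "embedding 3 n \<alpha> \<longleftrightarrow>
    \<alpha> 0 = 0 \<and> 0 < \<alpha> 1 \<and> \<alpha> 1 < \<alpha> 2 \<and> \<alpha> 2 < \<alpha> 3 \<and> \<alpha> 3 \<le> n \<and> \<alpha> 4 = n + 1"
  unfolding embedding_def atLeastAtMost_1_3 strict_mono_on_def by auto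

lemma plot_231: "plot [2, 3, 1] = {(1, 2), (2, 3), (3, 1)}"
proof -
  have "plot [2, 3, 1] = (\<lambda>i. (i, [2, 3, 1] ! (i - 1))) ` {1..3}"
    by (auto simp: plot_def)
  then show ?thesis
    unfolding atLeastAtMost_1_3 by simp
qed

lemma avoids_231_iff:
  assumes \<pi>: "\<pi> \<in> permutations_of_set {1..n}"
  shows "avoids \<pi> (classical [2, 3, 1]) \<longleftrightarrow> av231 \<pi>"
proof -
  have n: "length \<pi> = n" "set \<pi> = {1..n}"
    using \<pi> unfolding in_permutations_of_set_iff by auto
  have "av231 \<pi>" if av: "avoids \<pi> (classical [2, 3, 1])"
    unfolding av231_iff_nth
  proof (intro allI impI notI)
    fix i j k
    assume ijk: "i < j" "j < k" "k < length \<pi>" "\<pi> ! k < \<pi> ! i \<and> \<pi> ! i < \<pi> ! j"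
    have "\<pi> ! k \<in> {1..n}" "\<pi> ! i \<in> {1..n}" "\<pi> ! j \<in> {1..n}"
      using ijk n by (metis nth_mem order.strict_trans)+
    note mem = this
    \<comment> \<open>Adding 1 converts indices to positions. Values are listed in increasing order,
      so the entry at \<open>k\<close>, which plays the 1, comes first in
      \<open>\<beta>\<close>.\<close>
    define \<alpha> where "\<alpha> = (\<lambda>s::nat. [0, i + 1, j + 1, k + 1, n + 1] ! s)"
    define \<beta> where "\<beta> = (\<lambda>s::nat. [0, \<pi> ! k, \<pi> ! i, \<pi> ! j, n + 1] ! s)"
    have e: "embedding 3 n \<alpha>" "embedding 3 n \<beta>"
      using ijk mem n by (auto simp: embedding_3_iff \<alpha>_def \<beta>_def)
    have "{(\<alpha> i, \<beta> j) |i j. (i, j) \<in> plot [2, 3, 1]} \<subseteq> plot \<pi>"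
      unfolding plot_231 using ijk by (auto simp: plot_def \<alpha>_def \<beta>_def)
    then have "occurrence (classical [2, 3, 1]) \<pi> {(\<alpha> i, \<beta> j) |i j. (i, j) \<in> plot [2, 3, 1]}"
      unfolding occurrence_def classical_def prod.case
      by (intro conjI exI[of _ \<alpha>] exI[of _ \<beta>] refl) (use e n in \<open>auto simp: numeral_3_eq_3\<close>)
    with av show False
      by (auto simp: avoids_def)
  qed
  moreover have "avoids \<pi> (classical [2, 3, 1])" if av: "av231 \<pi>"
    unfolding avoids_def
  proof
    assume "\<exists>\<omega>. occurrence (classical [2, 3, 1]) \<pi> \<omega>"
    then obtain \<alpha> \<beta> where e: "embedding 3 n \<alpha>" "embedding 3 n \<beta>"
      and sub: "{(\<alpha> i, \<beta> j) |i j. (i, j) \<in> plot [2, 3, 1]} \<subseteq> plot \<pi>"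
      by (auto simp: occurrence_def classical_def numeral_3_eq_3 n)
    have "(\<alpha> 1, \<beta> 2) \<in> plot \<pi>" "(\<alpha> 2, \<beta> 3) \<in> plot \<pi>" "(\<alpha> 3, \<beta> 1) \<in> plot \<pi>"
      using sub unfolding plot_231 by blast+
    then have "\<pi> ! (\<alpha> 1 - 1) = \<beta> 2" "\<pi> ! (\<alpha> 2 - 1) = \<beta> 3" "\<pi> ! (\<alpha> 3 - 1) = \<beta> 1"
      by (auto simp: plot_def)
    moreover have "\<alpha> 1 - 1 < \<alpha> 2 - 1" "\<alpha> 2 - 1 < \<alpha> 3 - 1" "\<alpha> 3 - 1 < length \<pi>"
      using e(1) n by (auto simp: embedding_3_iff)
    moreover have "\<beta> 1 < \<beta> 2" "\<beta> 2 < \<beta> 3"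
      using e(2) by (auto simp: embedding_3_iff)
    ultimately show False
      using av unfolding av231_iff_nth by metis
  qed
  ultimately show ?thesis by blast
qed

section \<open>Splitting 231-avoiding permutations at the first entry\<close>

definition perms231 :: "nat \<Rightarrow> nat list set" where
  "perms231 n = {\<pi> \<in> permutations_of_set {1..n}. av231 \<pi>}"

lemma perms231_iff:
  "\<pi> \<in> perms231 n \<longleftrightarrow> distinct \<pi> \<and> set \<pi> = {1..n} \<and> length \<pi> = n \<and> av231 \<pi>"
  unfolding perms231_def mem_Collect_eq in_permutations_of_set_iff by blast

lemma finite_perms231: "finite (perms231 n)"
  by (simp add: perms231_def)

lemma perms231_0: "perms231 0 = {[]}"
  by (auto simp: perms231_iff)

lemma sorted_wrtI: "(\<And>x y. x \<in> set xs \<Longrightarrow> y \<in> set xs \<Longrightarrow> P x y) \<Longrightarrow> sorted_wrt P xs"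
  by (induction xs) auto

text \<open>The 1 of a 231 is its last and least entry. If it lies in \<open>D\<close>, the two
  larger entries cannot lie in \<open>B\<close>; if it lies in \<open>B\<close>, so do the two
  before it.\<close>

lemma av231_append:
  assumes "\<And>b d. b \<in> set B \<Longrightarrow> d \<in> set D \<Longrightarrow> b < d"
  shows "av231 (B @ D) \<longleftrightarrow> av231 B \<and> av231 D"
  using assms
proof (induction B)
  case (Cons b B)
  have "sorted_wrt (\<lambda>x y. \<not> (y < b \<and> b < x)) D"
    using Cons.prems by (fastforce simp: sorted_wrt_iff_nth_less dest: nth_mem)
  moreover have "\<not> y < b" if "y \<in> set D" for y
    using Cons.prems[of b y] that by simp
  ultimately show ?case
    using Cons by (auto simp: sorted_wrt_append)
qed simp

lemma av231_map_add: "av231 (map ((+) k) D) \<longleftrightarrow> av231 D"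
  by (induction D) (auto simp: sorted_wrt_map)

text \<open>No entry below \<open>a\<close> may follow one above \<open>a\<close>, so the small
  entries form an initial segment and the two filters merely cut the list.\<close>

lemma filter_append_filter_eq:
  fixes ys :: "nat list"
  assumes "sorted_wrt (\<lambda>x y. \<not> (y < a \<and> a < x)) ys" "a \<notin> set ys"
  shows "filter (\<lambda>x. x < a) ys @ filter (\<lambda>x. a < x) ys = ys"
  using assms
proof (induction ys)
  case (Cons y ys)
  show ?case
  proof (cases "y < a")
    case False
    then have "\<forall>z \<in> set ys. a < z"
      using Cons.prems by (auto simp: le_less not_less)
    then show ?thesis
      using False Cons.prems by (auto simp: filter_empty_conv filter_id_conv le_less not_less)
  qed (use Cons in auto)
qed simp

text \<open>When \<open>B\<close> is a permutation of \<open>1, ..., length B\<close>, the entry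
  that separates it from the larger values is \<open>Suc (length B)\<close>. Storing the upper part
  unshifted makes both arguments permutations of an initial segment.\<close>

definition node :: "nat list \<Rightarrow> nat list \<Rightarrow> nat list" where
  "node B D = Suc (length B) # B @ map ((+) (Suc (length B))) D"

lemma node_in_perms231:
  assumes B: "B \<in> perms231 k" and D: "D \<in> perms231 l"
  shows "node B D \<in> perms231 (Suc (k + l))"
proof -
  have *: "set B = {1..k}" "length B = k" "distinct B" "av231 B"
      "set D = {1..l}" "length D = l" "distinct D" "av231 D"
    using B D by (auto simp: perms231_iff)
  have s: "(+) (Suc k) ` {1..l} = {k + 2..k + l + 1}"
    by (subst image_add_atLeastAtMost) auto
  have "av231 (B @ map ((+) (Suc k)) D)"
    by (subst av231_append) (auto simp: * av231_map_add)
  \<comment> \<open>An entry above \<open>Suc k\<close> lies in the shifted \<open>D\<close>, and so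
    does everything after it.\<close>
  moreover have "sorted_wrt (\<lambda>x y. \<not> (y < Suc k \<and> Suc k < x)) (B @ map ((+) (Suc k)) D)"
    unfolding sorted_wrt_append by (intro conjI sorted_wrtI) (auto simp: *)
  ultimately have "av231 (node B D)"
    by (simp add: node_def *)
  moreover have "set (node B D) = {1..Suc (k + l)}"
    unfolding node_def list.set set_append set_map * s by auto
  moreover have "distinct (node B D)"
    by (auto simp: node_def * distinct_map)
  ultimately show ?thesis
    by (simp add: perms231_iff node_def *)
qed

text \<open>With first entry \<open>a\<close>, the \<open>a - 1\<close> smaller entries come next by
  \<open>filter_append_filter_eq\<close>, and lowering the remaining ones by \<open>a\<close>
  standardises them; so \<open>k\<close> is \<open>a - 1\<close>.\<close>

lemma perms231_Suc_obtain:
  assumes "xs \<in> perms231 (Suc n)"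
  obtains k B D where "k \<le> n" "B \<in> perms231 k" "D \<in> perms231 (n - k)" "xs = node B D"
proof -
  from assms obtain a ys where xs: "xs = a # ys"
    by (cases xs) (auto simp: perms231_iff)
  have *: "distinct ys" "a \<notin> set ys" "insert a (set ys) = {1..Suc n}" "av231 ys"
      "sorted_wrt (\<lambda>x y. \<not> (y < a \<and> a < x)) ys"
    using assms by (auto simp: perms231_iff xs)
  have a: "1 \<le> a" "a \<le> Suc n"
    using *(3) by auto
  have mem: "x \<in> set ys \<longleftrightarrow> 1 \<le> x \<and> x \<le> Suc n \<and> x \<noteq> a" for x
    using *(2,3) by (metis atLeastAtMost_iff insert_iff)
  define B E where "B = filter (\<lambda>x. x < a) ys" and "E = filter (\<lambda>x. a < x) ys"
  define D where "D = map (\<lambda>x. x - a) E"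
  have ys: "ys = B @ E"
    using filter_append_filter_eq[OF *(5,2)] by (simp add: B_def E_def)
  have E: "E = map ((+) a) D"
    by (simp add: D_def o_def) (rule map_idI[symmetric], simp add: E_def)
  have "av231 B \<and> av231 E"
    using *(4) unfolding ys by (subst (asm) av231_append) (auto simp: B_def E_def)
  then have av: "av231 B" "av231 D"
    by (auto simp: E av231_map_add)
  have d: "distinct B" "distinct D"
    using *(1) unfolding ys E by (auto simp: distinct_map)
  have setB: "set B = {1..a - 1}"
    using a by (auto simp: B_def mem)
  then have lenB: "length B = a - 1"
    using distinct_card[OF d(1)] by simp
  \<comment> \<open>\<open>n - (a - 1)\<close> equals \<open>Suc n - a\<close>, the number of values
    above \<open>a\<close>.\<close>
  have "set D = {1..n - (a - 1)}"
  proof (intro set_eqI iffI)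
    fix x assume "x \<in> set D"
    then show "x \<in> {1..n - (a - 1)}"
      using a by (auto simp: D_def E_def mem)
  next
    fix x assume "x \<in> {1..n - (a - 1)}"
    then have "a + x \<in> set E"
      using a by (auto simp: E_def mem)
    then show "x \<in> set D"
      by (force simp: D_def)
  qed
  moreover from this have "length D = n - (a - 1)"
    using distinct_card[OF d(2)] by simp
  ultimately have "D \<in> perms231 (n - (a - 1))"
    by (simp add: perms231_iff d av)
  moreover have "B \<in> perms231 (a - 1)"
    by (simp add: perms231_iff d av setB lenB)
  moreover have "xs = node B D"
    using a by (simp add: xs node_def lenB ys flip: E)
  ultimately show ?thesis
    using that[of "a - 1"] a by auto
qed

text \<open>The first entry records \<open>length B\<close>, which fixes where the rest is cut and
  by how much its end is shifted.\<close>

lemma node_eq_iff: "node B D = node B' D' \<longleftrightarrow> B = B' \<and> D = D'"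
  by (auto simp: node_def inj_map_eq_map)

section \<open>Generating functions of classes of 231-avoiders\<close>

definition gf231 :: "(nat list \<Rightarrow> bool) \<Rightarrow> int fps" where
  "gf231 P = Abs_fps (\<lambda>n. int (card {\<pi> \<in> perms231 n. P \<pi>}))"

text \<open>\<open>node\<close> maps pairs of 231-avoiders bijectively onto the nonempty
  231-avoiders. The factor \<open>fps_X\<close> accounts for the first entry, the 1 for
  \<open>[]\<close>.\<close>

lemma gf231_node:
  assumes "R []"
    and "\<And>B D k l. B \<in> perms231 k \<Longrightarrow> D \<in> perms231 l \<Longrightarrow> R (node B D) \<longleftrightarrow> P B \<and> Q D"
  shows "gf231 R = 1 + fps_X * gf231 P * gf231 Q"
proof (rule fps_ext)
  fix n
  show "fps_nth (gf231 R) n = fps_nth (1 + fps_X * gf231 P * gf231 Q) n"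
  proof (cases n)
    case 0
    have "{\<pi> \<in> perms231 0. R \<pi>} = {[]}"
      using assms(1) by (auto simp: perms231_0)
    then show ?thesis
      by (simp add: 0 gf231_def mult.assoc)
  next
    case (Suc m)
    \<comment> \<open>Carrying the length \<open>k\<close> of \<open>B\<close> along makes the
      cardinality of \<open>T\<close> a Cauchy product coefficient.\<close>
    define T where "T = (SIGMA k:{0..m}. {B \<in> perms231 k. P B} \<times> {D \<in> perms231 (m - k). Q D})"
    have "{\<pi> \<in> perms231 (Suc m). R \<pi>} = (\<lambda>(k, B, D). node B D) ` T"
    proof (intro set_eqI iffI)
      fix \<pi> assume "\<pi> \<in> {\<pi> \<in> perms231 (Suc m). R \<pi>}"
      then have \<pi>: "\<pi> \<in> perms231 (Suc m)" "R \<pi>" by auto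
      from \<pi>(1) obtain k B D where *: "k \<le> m" "B \<in> perms231 k" "D \<in> perms231 (m - k)" "\<pi> = node B D"
        by (rule perms231_Suc_obtain)
      then have "(k, B, D) \<in> T"
        using \<pi>(2) assms(2)[OF *(2,3)] by (simp add: T_def)
      with * show "\<pi> \<in> (\<lambda>(k, B, D). node B D) ` T"
        by force
    next
      fix \<pi> assume "\<pi> \<in> (\<lambda>(k, B, D). node B D) ` T"
      then obtain k B D where *: "k \<le> m" "B \<in> perms231 k" "D \<in> perms231 (m - k)" "\<pi> = node B D"
        "P B" "Q D"
        by (auto simp: T_def)
      then show "\<pi> \<in> {\<pi> \<in> perms231 (Suc m). R \<pi>}"
        using node_in_perms231[OF *(2,3)] assms(2)[OF *(2,3)] by simp
    qed
    moreover have "inj_on (\<lambda>(k, B, D). node B D) T"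
      by (auto simp: inj_on_def T_def node_eq_iff perms231_iff)
    ultimately have "card {\<pi> \<in> perms231 (Suc m). R \<pi>} = card T"
      by (simp add: card_image)
    also have "\<dots> = (\<Sum>k=0..m. card {B \<in> perms231 k. P B} * card {D \<in> perms231 (m - k). Q D})"
      unfolding T_def
      by (subst card_SigmaI) (auto simp: finite_perms231 card_cartesian_product)
    finally show ?thesis
      \<comment> \<open>Reassociating puts \<open>fps_X\<close> outermost, so coefficient
        \<open>Suc m\<close> becomes coefficient \<open>m\<close> of the product of the two
        series.\<close>
      by (simp add: Suc gf231_def mult.assoc) (simp add: fps_mult_nth)
  qed
qed

text \<open>Splitting without restriction gives the Catalan equation, whose solution is
  unique.\<close>

lemma gf231_True: "gf231 (\<lambda>_. True) = catalan_gf"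
proof -
  have "gf231 (\<lambda>_. True) = 1 + fps_X * gf231 (\<lambda>_. True) ^ 2"
    by (subst gf231_node[of "\<lambda>_. True" "\<lambda>_. True" "\<lambda>_. True"])
      (simp_all add: power2_eq_square mult.assoc)
  then show ?thesis
    using catalan_gf_ex1 catalan_gf_eq by blast
qed

lemma gf231_nonempty: "gf231 (\<lambda>\<pi>. \<pi> \<noteq> []) = catalan_gf - 1"
proof (rule fps_ext)
  fix n
  have "{\<pi> \<in> perms231 n. \<pi> \<noteq> []} = (if n = 0 then {} else perms231 n)"
    by (auto simp: perms231_iff)
  then show "fps_nth (gf231 (\<lambda>\<pi>. \<pi> \<noteq> [])) n = fps_nth (catalan_gf - 1) n"
    by (simp add: gf231_def perms231_0 flip: gf231_True)
qed

section \<open>The four patterns and the decomposition at the first entry\<close>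

text \<open>The empty list fails this condition and a single entry satisfies it, and likewise for
  the next two definitions; the constant terms of the series below depend on this.\<close>

definition starts_min :: "nat list \<Rightarrow> bool" where
  "starts_min xs \<longleftrightarrow> (\<exists>x ys. xs = x # ys \<and> (\<forall>y \<in> set ys. x < y))"

definition starts_max :: "nat list \<Rightarrow> bool" where
  "starts_max xs \<longleftrightarrow> (\<exists>x ys. xs = x # ys \<and> (\<forall>y \<in> set ys. y < x))"

definition ends_max :: "nat list \<Rightarrow> bool" where
  "ends_max xs \<longleftrightarrow> (\<exists>ys x. xs = ys @ [x] \<and> (\<forall>y \<in> set ys. y < x))"

text \<open>Places an entry whose size excludes it from \<open>E\<close> inside \<open>B\<close>;
  \<open>V\<close> is the part of \<open>B\<close> that follows it.\<close>

lemma append_eq_left: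
  assumes "B @ E = U @ q # W" "q \<notin> set E"
  obtains V where "B = U @ q # V" "W = V @ E"
  using assms by (auto simp: append_eq_append_conv2 Cons_eq_append_conv append_eq_Cons_conv)

lemma append_eq_right:
  assumes "B @ E = U @ q # W" "q \<notin> set B"
  obtains V where "E = V @ q # W" "U = B @ V"
  using assms by (auto simp: append_eq_append_conv2 Cons_eq_append_conv append_eq_Cons_conv)

context
  fixes a :: nat and B E :: "nat list"
  assumes B_less: "\<And>b. b \<in> set B \<Longrightarrow> b < a"
    and E_greater: "\<And>e. e \<in> set E \<Longrightarrow> a < e"
begin

text \<open>If \<open>a\<close> is the lower point, the upper one lies in \<open>E\<close>.
  Otherwise \<open>a\<close> is in column 0, hence above \<open>q\<close>, so both points lie in
  \<open>B\<close>; conversely \<open>a\<close> and all of \<open>E\<close> lie above any occurrence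
  in \<open>B\<close>.\<close>

lemma contains1_Cons_append: "contains1 (a # B @ E) \<longleftrightarrow> contains1 B \<or> starts_min E"
proof
  assume "contains1 (a # B @ E)"
  then obtain A p B' q D where *: "a # B @ E = A @ p # B' @ q # D" "p < q"
    "\<forall>x \<in> set A. q < x" "\<forall>x \<in> set B'. x < p" "\<forall>x \<in> set D. q < x"
    unfolding contains1_def by blast
  show "contains1 B \<or> starts_min E"
  proof (cases A)
    case Nil
    then have eq: "p = a" "B @ E = B' @ q # D" using * by auto
    then have "q \<notin> set B" using B_less *(2) by force
    with eq(2) obtain V where V: "E = V @ q # D" "B' = B @ V"
      by (rule append_eq_right)
    \<comment> \<open>Entries of \<open>V\<close> belong to \<open>E\<close> and exceed
      \<open>a = p\<close>, but column 1 must stay below \<open>p\<close>.\<close>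
    have "V = []"
      using V *(4) E_greater eq by (cases V) force+
    then have "starts_min E"
      using V *(5) by (auto simp: starts_min_def)
    then show ?thesis ..
  next
    case (Cons a' A')
    then have eq: "a' = a" "B @ E = (A' @ p # B') @ q # D" using * by auto
    then have "q < a" using *(3) Cons by auto
    then have "q \<notin> set E" using E_greater by force
    with eq(2) obtain V where "B = (A' @ p # B') @ q # V" "D = V @ E"
      by (rule append_eq_left)
    then have "contains1 B"
      using * Cons unfolding contains1_def
      by (intro exI[of _ A'] exI[of _ p] exI[of _ B'] exI[of _ q] exI[of _ V]) auto
    then show ?thesis ..
  qed
next
  assume "contains1 B \<or> starts_min E"
  then show "contains1 (a # B @ E)"
  proof
    assume "contains1 B"
    then obtain A p B' q D where *: "B = A @ p # B' @ q # D" "p < q"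
      "\<forall>x \<in> set A. q < x" "\<forall>x \<in> set B'. x < p" "\<forall>x \<in> set D. q < x"
      unfolding contains1_def by blast
    have "q < a" using *(1) B_less by auto
    moreover from this have "\<forall>e \<in> set E. q < e"
      using E_greater by (meson order.strict_trans)
    ultimately show ?thesis
      using * unfolding contains1_def
      by (intro exI[of _ "a # A"] exI[of _ p] exI[of _ B'] exI[of _ q] exI[of _ "D @ E"]) auto
  next
    assume "starts_min E"
    then obtain q D where "E = q # D" "\<forall>y \<in> set D. q < y"
      by (auto simp: starts_min_def)
    then show ?thesis
      using B_less E_greater unfolding contains1_def
      by (intro exI[of _ "[]"] exI[of _ a] exI[of _ B] exI[of _ q] exI[of _ D]) auto
  qed
qed

text \<open>If \<open>a\<close> is the upper point, the lower one lies in \<open>B\<close>.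
  Otherwise \<open>a\<close> is in column 0, above \<open>q\<close>, which again forces both points
  into \<open>B\<close>.\<close>

lemma contains2_Cons_append: "contains2 (a # B @ E) \<longleftrightarrow> contains2 B \<or> ends_max B"
proof
  assume "contains2 (a # B @ E)"
  then obtain A p B' q D where *: "a # B @ E = A @ q # B' @ p # D" "p < q"
    "\<forall>x \<in> set A. q < x" "\<forall>x \<in> set B'. x < p" "\<forall>x \<in> set D. q < x"
    unfolding contains2_def by blast
  show "contains2 B \<or> ends_max B"
  proof (cases A)
    case Nil
    then have eq: "q = a" "B @ E = B' @ p # D" using * by auto
    then have "p \<notin> set E" using E_greater *(2) by force
    with eq(2) obtain V where V: "B = B' @ p # V" "D = V @ E"
      by (rule append_eq_left)
    \<comment> \<open>Entries of \<open>V\<close> belong to \<open>B\<close> and are below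
      \<open>a = q\<close>, but column 2 must stay above \<open>q\<close>.\<close>
    have "V = []"
      using V *(5) B_less eq by (cases V) force+
    then have "ends_max B"
      using V *(4) by (auto simp: ends_max_def)
    then show ?thesis ..
  next
    case (Cons a' A')
    then have eq: "a' = a" "B @ E = (A' @ q # B') @ p # D" using * by auto
    then have "q < a" using *(3) Cons by auto
    then have "p \<notin> set E" using E_greater *(2) by force
    with eq(2) obtain V where "B = (A' @ q # B') @ p # V" "D = V @ E"
      by (rule append_eq_left)
    then have "contains2 B"
      using * Cons unfolding contains2_def
      by (intro exI[of _ A'] exI[of _ p] exI[of _ B'] exI[of _ q] exI[of _ V]) auto
    then show ?thesis ..
  qed
next
  assume "contains2 B \<or> ends_max B"
  then show "contains2 (a # B @ E)"
  proof
    assume "contains2 B"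
    then obtain A p B' q D where *: "B = A @ q # B' @ p # D" "p < q"
      "\<forall>x \<in> set A. q < x" "\<forall>x \<in> set B'. x < p" "\<forall>x \<in> set D. q < x"
      unfolding contains2_def by blast
    have "q < a" using *(1) B_less by auto
    moreover from this have "\<forall>e \<in> set E. q < e"
      using E_greater by (meson order.strict_trans)
    ultimately show ?thesis
      using * unfolding contains2_def
      by (intro exI[of _ "a # A"] exI[of _ p] exI[of _ B'] exI[of _ q] exI[of _ "D @ E"]) auto
  next
    assume "ends_max B"
    then obtain B' p where "B = B' @ [p]" "\<forall>y \<in> set B'. y < p"
      by (auto simp: ends_max_def)
    then show ?thesis
      using B_less E_greater unfolding contains2_def
      by (intro exI[of _ "[]"] exI[of _ p] exI[of _ B'] exI[of _ a] exI[of _ E]) auto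
  qed
qed

text \<open>If \<open>a\<close> is the upper point, the lower one is the next entry and, being
  smaller, heads \<open>B\<close>. Otherwise \<open>a\<close> is in column 0, below
  \<open>p\<close>, so both points lie in \<open>E\<close>; conversely \<open>a\<close> and all of
  \<open>B\<close> lie below any occurrence in \<open>E\<close>.\<close>

lemma contains3_Cons_append: "contains3 (a # B @ E) \<longleftrightarrow> starts_max B \<or> contains3 E"
proof
  assume "contains3 (a # B @ E)"
  then obtain A p q D where *: "a # B @ E = A @ q # p # D" "p < q"
    "\<forall>x \<in> set A. x < p" "\<forall>x \<in> set D. x < p \<or> q < x"
    unfolding contains3_def by blast
  show "starts_max B \<or> contains3 E"
  proof (cases A)
    case Nil
    then have eq: "q = a" "B @ E = [] @ p # D" using * by auto
    then have "p \<notin> set E" using E_greater *(2) by force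
    with eq(2) obtain V where "B = [] @ p # V" "D = V @ E"
      by (rule append_eq_left)
    \<comment> \<open>The rest of \<open>B\<close> is below \<open>a = q\<close>, so column 2 leaves
      it only the values below \<open>p\<close>.\<close>
    then have "starts_max B"
      using *(4) B_less eq by (fastforce simp: starts_max_def)
    then show ?thesis ..
  next
    case (Cons a' A')
    then have eq: "a' = a" "B @ E = A' @ q # p # D" using * by auto
    then have "a < p" using *(3) Cons by auto
    then have "q \<notin> set B" using B_less *(2) by force
    with eq(2) obtain V where "E = V @ q # p # D" "A' = B @ V"
      by (rule append_eq_right)
    then have "contains3 E"
      using * Cons unfolding contains3_def
      by (intro exI[of _ V] exI[of _ p] exI[of _ q] exI[of _ D]) auto
    then show ?thesis ..
  qed
next
  assume "starts_max B \<or> contains3 E"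
  then show "contains3 (a # B @ E)"
  proof
    assume "starts_max B"
    then obtain p V where "B = p # V" "\<forall>y \<in> set V. y < p"
      by (auto simp: starts_max_def)
    then show ?thesis
      using B_less E_greater unfolding contains3_def
      by (intro exI[of _ "[]"] exI[of _ p] exI[of _ a] exI[of _ "V @ E"]) auto
  next
    assume "contains3 E"
    then obtain A p q D where *: "E = A @ q # p # D" "p < q"
      "\<forall>x \<in> set A. x < p" "\<forall>x \<in> set D. x < p \<or> q < x"
      unfolding contains3_def by blast
    have "a < p" using *(1) E_greater by auto
    moreover from this have "\<forall>b \<in> set B. b < p"
      using B_less by (meson order.strict_trans)
    ultimately show ?thesis
      using * unfolding contains3_def
      by (intro exI[of _ "a # B @ A"] exI[of _ p] exI[of _ q] exI[of _ D]) auto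
  qed
qed

text \<open>The argument for \<open>contains3\<close> carries over, except that column 2 now lies
  above \<open>p\<close>, which makes the head of \<open>B\<close> its minimum.\<close>

lemma contains4_Cons_append: "contains4 (a # B @ E) \<longleftrightarrow> starts_min B \<or> contains4 E"
proof
  assume "contains4 (a # B @ E)"
  then obtain A p q D where *: "a # B @ E = A @ q # p # D" "p < q"
    "\<forall>x \<in> set A. x < p" "\<forall>x \<in> set D. p < x"
    unfolding contains4_def by blast
  show "starts_min B \<or> contains4 E"
  proof (cases A)
    case Nil
    then have eq: "q = a" "B @ E = [] @ p # D" using * by auto
    then have "p \<notin> set E" using E_greater *(2) by force
    with eq(2) obtain V where "B = [] @ p # V" "D = V @ E"
      by (rule append_eq_left)
    then have "starts_min B"
      using *(4) by (auto simp: starts_min_def)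
    then show ?thesis ..
  next
    case (Cons a' A')
    then have eq: "a' = a" "B @ E = A' @ q # p # D" using * by auto
    then have "a < p" using *(3) Cons by auto
    then have "q \<notin> set B" using B_less *(2) by force
    with eq(2) obtain V where "E = V @ q # p # D" "A' = B @ V"
      by (rule append_eq_right)
    then have "contains4 E"
      using * Cons unfolding contains4_def
      by (intro exI[of _ V] exI[of _ p] exI[of _ q] exI[of _ D]) auto
    then show ?thesis ..
  qed
next
  assume "starts_min B \<or> contains4 E"
  then show "contains4 (a # B @ E)"
  proof
    assume "starts_min B"
    then obtain p V where "B = p # V" "\<forall>y \<in> set V. p < y"
      by (auto simp: starts_min_def)
    moreover from this have "p < a"
      using B_less by simp
    moreover from this have "\<forall>e \<in> set E. p < e"
      using E_greater by (meson order.strict_trans)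
    ultimately show ?thesis
      unfolding contains4_def
      by (intro exI[of _ "[]"] exI[of _ p] exI[of _ a] exI[of _ "V @ E"]) auto
  next
    assume "contains4 E"
    then obtain A p q D where *: "E = A @ q # p # D" "p < q"
      "\<forall>x \<in> set A. x < p" "\<forall>x \<in> set D. p < x"
      unfolding contains4_def by blast
    have "a < p" using *(1) E_greater by auto
    moreover from this have "\<forall>b \<in> set B. b < p"
      using B_less by (meson order.strict_trans)
    ultimately show ?thesis
      using * unfolding contains4_def
      by (intro exI[of _ "a # B @ A"] exI[of _ p] exI[of _ q] exI[of _ D]) auto
  qed
qed

lemma starts_min_Cons_append: "starts_min (a # B @ E) \<longleftrightarrow> B = []"
  using B_less E_greater by (cases B) (force simp: starts_min_def)+

lemma starts_max_Cons_append: "starts_max (a # B @ E) \<longleftrightarrow> E = []"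
  using B_less E_greater by (cases E) (force simp: starts_max_def)+

end

text \<open>\<open>node\<close> shifts its second argument, so conditions that fall on the upper
  part have to be invariant under shifts.\<close>

lemma starts_min_map_add: "starts_min (map ((+) k) D) \<longleftrightarrow> starts_min D"
  by (cases D) (auto simp: starts_min_def)

lemma contains3_map_add: "contains3 (map ((+) k) D) \<longleftrightarrow> contains3 D"
proof
  assume "contains3 (map ((+) k) D)"
  then obtain A p q E where *: "map ((+) k) D = A @ q # p # E" "p < q"
    "\<forall>x \<in> set A. x < p" "\<forall>x \<in> set E. x < p \<or> q < x"
    unfolding contains3_def by blast
  from *(1) obtain A' p' q' E' where "D = A' @ q' # p' # E'" "A = map ((+) k) A'" "p = k + p'"
    "q = k + q'" "E = map ((+) k) E'"
    by (auto simp: map_eq_append_conv map_eq_Cons_conv)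
  with * show "contains3 D"
    unfolding contains3_def
    by (intro exI[of _ A'] exI[of _ p'] exI[of _ q'] exI[of _ E']) auto
next
  assume "contains3 D"
  then obtain A p q E where "D = A @ q # p # E" "p < q"
    "\<forall>x \<in> set A. x < p" "\<forall>x \<in> set E. x < p \<or> q < x"
    unfolding contains3_def by blast
  then show "contains3 (map ((+) k) D)"
    unfolding contains3_def
    by (intro exI[of _ "map ((+) k) A"] exI[of _ "k + p"] exI[of _ "k + q"]
        exI[of _ "map ((+) k) E"]) auto
qed

lemma contains4_map_add: "contains4 (map ((+) k) D) \<longleftrightarrow> contains4 D"
proof
  assume "contains4 (map ((+) k) D)"
  then obtain A p q E where *: "map ((+) k) D = A @ q # p # E" "p < q"
    "\<forall>x \<in> set A. x < p" "\<forall>x \<in> set E. p < x"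
    unfolding contains4_def by blast
  from *(1) obtain A' p' q' E' where "D = A' @ q' # p' # E'" "A = map ((+) k) A'" "p = k + p'"
    "q = k + q'" "E = map ((+) k) E'"
    by (auto simp: map_eq_append_conv map_eq_Cons_conv)
  with * show "contains4 D"
    unfolding contains4_def
    by (intro exI[of _ A'] exI[of _ p'] exI[of _ q'] exI[of _ E']) auto
next
  assume "contains4 D"
  then obtain A p q E where "D = A @ q # p # E" "p < q"
    "\<forall>x \<in> set A. x < p" "\<forall>x \<in> set E. p < x"
    unfolding contains4_def by blast
  then show "contains4 (map ((+) k) D)"
    unfolding contains4_def
    by (intro exI[of _ "map ((+) k) A"] exI[of _ "k + p"] exI[of _ "k + q"]
        exI[of _ "map ((+) k) E"]) auto
qed

context
  fixes B D :: "nat list" and k l :: nat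
  assumes B: "B \<in> perms231 k" and D: "D \<in> perms231 l"
begin

private lemma node_parts:
  "\<And>b. b \<in> set B \<Longrightarrow> b < Suc (length B)"
  "\<And>e. e \<in> set (map ((+) (Suc (length B))) D) \<Longrightarrow> Suc (length B) < e"
  using B D by (auto simp: perms231_iff)

lemma contains1_node: "contains1 (node B D) \<longleftrightarrow> contains1 B \<or> starts_min D"
  unfolding node_def using contains1_Cons_append[OF node_parts] starts_min_map_add by metis

lemma contains2_node: "contains2 (node B D) \<longleftrightarrow> contains2 B \<or> ends_max B"
  unfolding node_def using contains2_Cons_append[OF node_parts] by metis

lemma contains3_node: "contains3 (node B D) \<longleftrightarrow> starts_max B \<or> contains3 D"
  unfolding node_def using contains3_Cons_append[OF node_parts] contains3_map_add by metis

lemma contains4_node: "contains4 (node B D) \<longleftrightarrow> starts_min B \<or> contains4 D"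
  unfolding node_def using contains4_Cons_append[OF node_parts] contains4_map_add by metis

lemma starts_min_node: "starts_min (node B D) \<longleftrightarrow> B = []"
  unfolding node_def using starts_min_Cons_append[OF node_parts] by metis

lemma starts_max_node: "starts_max (node B D) \<longleftrightarrow> D = []"
  unfolding node_def using starts_max_Cons_append[OF node_parts] by (metis map_is_Nil_conv)

end

section \<open>Functional equations for the four classes\<close>

text \<open>By \<open>starts_min_node\<close> the first argument of \<open>node\<close> must be
  nonempty and the second is free. The resulting series is the \<open>M\<close> of the
  theorem.\<close>

lemma gf231_not_starts_min:
  "gf231 (\<lambda>\<pi>. \<not> starts_min \<pi>) = 1 + fps_X * catalan_gf * (catalan_gf - 1)"
proof -
  have "gf231 (\<lambda>\<pi>. \<not> starts_min \<pi>) = 1 + fps_X * gf231 (\<lambda>\<pi>. \<pi> \<noteq> []) * gf231 (\<lambda>_. True)"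
    by (rule gf231_node) (auto simp: starts_min_node, simp add: starts_min_def)
  then show ?thesis
    by (simp add: gf231_nonempty gf231_True mult_ac)
qed

text \<open>Now the second argument must be nonempty and the first is free, so the product is the
  same.\<close>

lemma gf231_not_starts_max:
  "gf231 (\<lambda>\<pi>. \<not> starts_max \<pi>) = 1 + fps_X * catalan_gf * (catalan_gf - 1)"
proof -
  have "gf231 (\<lambda>\<pi>. \<not> starts_max \<pi>) = 1 + fps_X * gf231 (\<lambda>_. True) * gf231 (\<lambda>\<pi>. \<pi> \<noteq> [])"
    by (rule gf231_node) (auto simp: starts_max_node, simp add: starts_max_def)
  then show ?thesis
    by (simp add: gf231_nonempty gf231_True mult_ac)
qed

text \<open>As the largest entry \<open>m\<close> is not the lower point, and as the last entry it
  is not the upper one, which has the lower one after it. So \<open>m\<close> lies in column 2,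
  where entries above \<open>q\<close> are allowed.\<close>

lemma contains2_append_max:
  assumes "\<And>y. y \<in> set ys \<Longrightarrow> y < m"
  shows "contains2 (ys @ [m]) \<longleftrightarrow> contains2 ys"
proof
  assume "contains2 (ys @ [m])"
  then obtain A p B q D where *: "ys @ [m] = A @ q # B @ p # D" "p < q"
    "\<forall>x \<in> set A. q < x" "\<forall>x \<in> set B. x < p" "\<forall>x \<in> set D. q < x"
    unfolding contains2_def by blast
  have eq: "ys @ [m] = (A @ q # B) @ p # D"
    using *(1) by simp
  have "p \<noteq> m"
  proof
    assume "p = m"
    then have "p \<notin> set ys" using assms by blast
    with eq obtain V where "[m] = V @ p # D" "A @ q # B = ys @ V"
      by (rule append_eq_right)
    then have "ys = A @ q # B"
      by (auto simp: Cons_eq_append_conv)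
    then show False
      using assms[of q] *(2) \<open>p = m\<close> by simp
  qed
  then have "p \<notin> set [m]" by simp
  with eq obtain V where "ys = (A @ q # B) @ p # V" "D = V @ [m]"
    by (rule append_eq_left)
  then show "contains2 ys"
    using * unfolding contains2_def
    by (intro exI[of _ A] exI[of _ p] exI[of _ B] exI[of _ q] exI[of _ V]) auto
next
  assume "contains2 ys"
  then obtain A p B q D where "ys = A @ q # B @ p # D" "p < q"
    "\<forall>x \<in> set A. q < x" "\<forall>x \<in> set B. x < p" "\<forall>x \<in> set D. q < x"
    unfolding contains2_def by blast
  then show "contains2 (ys @ [m])"
    using assms unfolding contains2_def
    by (intro exI[of _ A] exI[of _ p] exI[of _ B] exI[of _ q] exI[of _ "D @ [m]"]) auto
qed

lemma perms231_append_max: "ys @ [Suc n] \<in> perms231 (Suc n) \<longleftrightarrow> ys \<in> perms231 n"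
proof -
  have av: "av231 (ys @ [Suc n]) \<longleftrightarrow> av231 ys" if "set ys = {1..n}"
    using that by (subst av231_append) auto
  have "distinct (ys @ [Suc n]) \<and> set (ys @ [Suc n]) = {1..Suc n} \<longleftrightarrow>
      distinct ys \<and> set ys = {1..n}"
  proof
    assume *: "distinct (ys @ [Suc n]) \<and> set (ys @ [Suc n]) = {1..Suc n}"
    then have "set ys = {1..Suc n} - {Suc n}"
      by auto
    also have "\<dots> = {1..n}"
      by auto
    finally show "distinct ys \<and> set ys = {1..n}"
      using * by simp
  next
    assume "distinct ys \<and> set ys = {1..n}"
    then show "distinct (ys @ [Suc n]) \<and> set (ys @ [Suc n]) = {1..Suc n}"
      by (simp add: atLeastAtMostSuc_conv)
  qed
  then show ?thesis
    unfolding perms231_iff using av by auto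
qed

text \<open>A final maximum must be \<open>Suc n\<close>, and removing or appending it affects
  neither 231-avoidance nor \<open>contains2\<close>.\<close>

lemma avoiders2_ends_max_eq:
  "{\<pi> \<in> perms231 (Suc n). \<not> contains2 \<pi> \<and> ends_max \<pi>} =
    (\<lambda>\<pi>. \<pi> @ [Suc n]) ` {\<pi> \<in> perms231 n. \<not> contains2 \<pi>}"
proof (intro set_eqI iffI)
  fix \<pi> assume "\<pi> \<in> {\<pi> \<in> perms231 (Suc n). \<not> contains2 \<pi> \<and> ends_max \<pi>}"
  then obtain ys x where *: "\<pi> \<in> perms231 (Suc n)" "\<not> contains2 \<pi>" "\<pi> = ys @ [x]"
    "\<forall>y \<in> set ys. y < x"
    by (auto simp: ends_max_def)
  then have "Suc n \<in> insert x (set ys)" "x \<le> Suc n"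
    by (auto simp: perms231_iff)
  then have "x = Suc n"
    using *(4) by force
  then show "\<pi> \<in> (\<lambda>\<pi>. \<pi> @ [Suc n]) ` {\<pi> \<in> perms231 n. \<not> contains2 \<pi>}"
    using * contains2_append_max[of ys x] perms231_append_max by auto
next
  fix \<pi> assume "\<pi> \<in> (\<lambda>\<pi>. \<pi> @ [Suc n]) ` {\<pi> \<in> perms231 n. \<not> contains2 \<pi>}"
  then obtain ys where *: "\<pi> = ys @ [Suc n]" "ys \<in> perms231 n" "\<not> contains2 ys"
    by auto
  then have "\<forall>y \<in> set ys. y < Suc n"
    by (auto simp: perms231_iff)
  then show "\<pi> \<in> {\<pi> \<in> perms231 (Suc n). \<not> contains2 \<pi> \<and> ends_max \<pi>}"
    using * contains2_append_max[of ys "Suc n"] perms231_append_max by (auto simp: ends_max_def)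
qed

text \<open>Avoiders that end with their maximum arise from those one shorter, which accounts for
  the term with \<open>fps_X\<close>; the empty permutation is not among them.\<close>

lemma gf231_avoiders2_split:
  "gf231 (\<lambda>\<pi>. \<not> contains2 \<pi>) =
    gf231 (\<lambda>\<pi>. \<not> contains2 \<pi> \<and> \<not> ends_max \<pi>) + fps_X * gf231 (\<lambda>\<pi>. \<not> contains2 \<pi>)"
proof (rule fps_ext)
  fix n
  have split: "{\<pi> \<in> perms231 n. \<not> contains2 \<pi>} =
      {\<pi> \<in> perms231 n. \<not> contains2 \<pi> \<and> \<not> ends_max \<pi>} \<union> {\<pi> \<in> perms231 n. \<not> contains2 \<pi> \<and> ends_max \<pi>}"
    by auto
  have "card {\<pi> \<in> perms231 n. \<not> contains2 \<pi>} =
      card {\<pi> \<in> perms231 n. \<not> contains2 \<pi> \<and> \<not> ends_max \<pi>} +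
      card {\<pi> \<in> perms231 n. \<not> contains2 \<pi> \<and> ends_max \<pi>}"
    by (subst split, rule card_Un_disjoint) (auto simp: finite_perms231)
  moreover have "card {\<pi> \<in> perms231 n. \<not> contains2 \<pi> \<and> ends_max \<pi>} =
      (if n = 0 then 0 else card {\<pi> \<in> perms231 (n - 1). \<not> contains2 \<pi>})"
  proof (cases n)
    case 0
    have "{\<pi> \<in> perms231 0. \<not> contains2 \<pi> \<and> ends_max \<pi>} = {}"
      by (auto simp: perms231_0 ends_max_def)
    then show ?thesis
      by (simp only: 0) simp
  next
    case (Suc m)
    then show ?thesis
      by (simp add: avoiders2_ends_max_eq card_image inj_on_def)
  qed
  ultimately show "fps_nth (gf231 (\<lambda>\<pi>. \<not> contains2 \<pi>)) n =
      fps_nth (gf231 (\<lambda>\<pi>. \<not> contains2 \<pi> \<and> \<not> ends_max \<pi>) + fps_X * gf231 (\<lambda>\<pi>. \<not> contains2 \<pi>)) n"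
    by (simp add: gf231_def)
qed

text \<open>The recursion runs through the first argument of \<open>node\<close>; the second
  contributes the factor \<open>M\<close>.\<close>

lemma gf231_avoiders1:
  "gf231 (\<lambda>\<pi>. \<not> contains1 \<pi>) =
    1 + fps_X * gf231 (\<lambda>\<pi>. \<not> contains1 \<pi>) * (1 + fps_X * catalan_gf * (catalan_gf - 1))"
  unfolding gf231_not_starts_min[symmetric]
  by (rule gf231_node) (auto simp: contains1_node, simp add: contains1_def)

text \<open>\<open>contains2_node\<close> restricts only the first argument of \<open>node\<close>,
  so the second contributes all of \<open>C\<close>; \<open>gf231_avoiders2_split\<close> then
  expresses \<open>G\<close> through \<open>P\<close>.\<close>

lemma gf231_avoiders2:
  "gf231 (\<lambda>\<pi>. \<not> contains2 \<pi>) =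
    1 + fps_X * gf231 (\<lambda>\<pi>. \<not> contains2 \<pi>) * (1 + fps_X * catalan_gf * (catalan_gf - 1))"
proof -
  define P G C where "P = gf231 (\<lambda>\<pi>. \<not> contains2 \<pi>)"
    and "G = gf231 (\<lambda>\<pi>. \<not> contains2 \<pi> \<and> \<not> ends_max \<pi>)" and "C = catalan_gf"
  have P: "P = 1 + fps_X * G * C"
    unfolding P_def G_def C_def gf231_True[symmetric]
    by (rule gf231_node) (auto simp: contains2_node, simp add: contains2_def)
  have G: "G = P - fps_X * P"
    unfolding P_def G_def eq_diff_eq by (rule gf231_avoiders2_split[symmetric])
  \<comment> \<open>Replacing the leading \<open>C\<close> by \<open>1 + fps_X * C ^ 2\<close>
    produces \<open>M\<close>.\<close>
  have "C - fps_X * C = 1 + fps_X * C * (C - 1)"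
    using catalan_gf_eq by (simp add: C_def algebra_simps power2_eq_square)
  moreover have "P = 1 + fps_X * P * (C - fps_X * C)"
    using P unfolding G by (simp add: algebra_simps)
  ultimately show ?thesis
    by (simp add: P_def C_def)
qed

text \<open>Here the recursion runs through the second argument and the first contributes
  \<open>M\<close>.\<close>

lemma gf231_avoiders3:
  "gf231 (\<lambda>\<pi>. \<not> contains3 \<pi>) =
    1 + fps_X * gf231 (\<lambda>\<pi>. \<not> contains3 \<pi>) * (1 + fps_X * catalan_gf * (catalan_gf - 1))"
proof -
  have "gf231 (\<lambda>\<pi>. \<not> contains3 \<pi>) =
      1 + fps_X * gf231 (\<lambda>\<pi>. \<not> starts_max \<pi>) * gf231 (\<lambda>\<pi>. \<not> contains3 \<pi>)"
    by (rule gf231_node) (auto simp: contains3_node, simp add: contains3_def)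
  then show ?thesis
    by (simp only: gf231_not_starts_max mult_ac)
qed

lemma gf231_avoiders4:
  "gf231 (\<lambda>\<pi>. \<not> contains4 \<pi>) =
    1 + fps_X * gf231 (\<lambda>\<pi>. \<not> contains4 \<pi>) * (1 + fps_X * catalan_gf * (catalan_gf - 1))"
proof -
  have "gf231 (\<lambda>\<pi>. \<not> contains4 \<pi>) =
      1 + fps_X * gf231 (\<lambda>\<pi>. \<not> starts_min \<pi>) * gf231 (\<lambda>\<pi>. \<not> contains4 \<pi>)"
    by (rule gf231_node) (auto simp: contains4_node, simp add: contains4_def)
  then show ?thesis
    by (simp only: gf231_not_starts_min mult_ac)
qed

section \<open>Return to the mesh patterns and Wilf-equivalence\<close>

lemma Av_gf_eq_gf231:
  assumes "\<And>\<pi> n. \<pi> \<in> permutations_of_set {1..n} \<Longrightarrow> avoids \<pi> m \<longleftrightarrow> P \<pi>"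
  shows "Av_gf {classical [2, 3, 1], m} = gf231 P"
proof -
  have "Av n {classical [2, 3, 1], m} = {\<pi> \<in> perms231 n. P \<pi>}" for n
    unfolding Av_def perms231_def using avoids_231_iff[of _ n] assms[of _ n] by auto
  then show ?thesis
    by (simp add: Av_gf_def gf231_def)
qed

lemma Av_gf_equation:
  assumes "m \<in> {m1, m2, m3, m4}"
  shows "Av_gf {classical [2, 3, 1], m} =
    1 + fps_X * Av_gf {classical [2, 3, 1], m} * (1 + fps_X * catalan_gf * (catalan_gf - 1))"
proof -
  from assms consider "m = m1" | "m = m2" | "m = m3" | "m = m4"
    by blast
  then show ?thesis
  proof cases
    case 1
    have "Av_gf {classical [2, 3, 1], m} = gf231 (\<lambda>\<pi>. \<not> contains1 \<pi>)"
      unfolding 1 by (rule Av_gf_eq_gf231) (rule avoids_m1_iff)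
    then show ?thesis
      using gf231_avoiders1 by simp
  next
    case 2
    have "Av_gf {classical [2, 3, 1], m} = gf231 (\<lambda>\<pi>. \<not> contains2 \<pi>)"
      unfolding 2 by (rule Av_gf_eq_gf231) (rule avoids_m2_iff)
    then show ?thesis
      using gf231_avoiders2 by simp
  next
    case 3
    have "Av_gf {classical [2, 3, 1], m} = gf231 (\<lambda>\<pi>. \<not> contains3 \<pi>)"
      unfolding 3 by (rule Av_gf_eq_gf231) (rule avoids_m3_iff)
    then show ?thesis
      using gf231_avoiders3 by simp
  next
    case 4
    have "Av_gf {classical [2, 3, 1], m} = gf231 (\<lambda>\<pi>. \<not> contains4 \<pi>)"
      unfolding 4 by (rule Av_gf_eq_gf231) (rule avoids_m4_iff)
    then show ?thesis
      using gf231_avoiders4 by simp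
  qed
qed

text \<open>\<open>1 - fps_X * M\<close> has constant term 1, so it is nonzero and can be cancelled
  over an integral domain.\<close>

lemma fps_linear_equation_unique:
  fixes P Q M :: "'a::idom fps"
  assumes "P = 1 + fps_X * P * M" "Q = 1 + fps_X * Q * M"
  shows "P = Q"
proof -
  have "P - Q = fps_X * P * M - fps_X * Q * M"
    by (subst assms(1), subst assms(2)) simp
  then have "(P - Q) * (1 - fps_X * M) = 0"
    by (simp add: algebra_simps)
  moreover have "fps_nth (1 - fps_X * M) 0 \<noteq> 0"
    by simp
  then have "1 - fps_X * M \<noteq> 0"
    by (metis fps_zero_nth)
  ultimately show ?thesis
    by simp
qed

theorem mainTheorem9:
  shows "(\<forall>n. \<forall>m \<in> {m1, m2, m3, m4}. \<forall>m' \<in> {m1, m2, m3, m4}.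
            card (Av n {classical [2, 3, 1], m}) = card (Av n {classical [2, 3, 1], m'}))
    \<and> (\<forall>m \<in> {m1, m2, m3, m4}.
          let P = Av_gf {classical [2, 3, 1], m};
              C = catalan_gf;
              M = 1 + fps_X * C * (C - 1)
          in P = 1 + fps_X * P * M)"
proof (intro conjI allI ballI)
  fix n m m' assume "m \<in> {m1, m2, m3, m4}" "m' \<in> {m1, m2, m3, m4}"
  \<comment> \<open>Both series solve the same linear equation, so equality of the counts follows
    without a bijection between the classes.\<close>
  then have "Av_gf {classical [2, 3, 1], m} = Av_gf {classical [2, 3, 1], m'}"
    using fps_linear_equation_unique[OF Av_gf_equation Av_gf_equation] by blast
  then have "fps_nth (Av_gf {classical [2, 3, 1], m}) n = fps_nth (Av_gf {classical [2, 3, 1], m'}) n"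
    by simp
  then show "card (Av n {classical [2, 3, 1], m}) = card (Av n {classical [2, 3, 1], m'})"
    by (simp add: Av_gf_def)
next
  fix m assume "m \<in> {m1, m2, m3, m4}"
  then show "let P = Av_gf {classical [2, 3, 1], m};
              C = catalan_gf;
              M = 1 + fps_X * C * (C - 1)
          in P = 1 + fps_X * P * M"
    unfolding Let_def by (rule Av_gf_equation)
qed

end
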